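(* A skew lattice $S$ is a left distributive solution of the Yang–Baxter equation if and only if $S$ is distributive and left cancellative.
   Context: A skew lattice is a set $S$ with two binary operations $\wedge,\vee$, each idempotent and associative, satisfying the absorption laws $x\wedge(x\vee y)=x=x\vee(x\wedge y)$ and $(x\wedge y)\vee y=y=(x\vee y)\wedge y$ for all $x,y\in S$. $S$ is distributive if it satisfies $x\wedge(y\vee z)\wedge x=(x\wedge y\wedge x)\vee(x\wedge z\wedge x)$ and $x\vee(y\wedge z)\vee x=(x\vee y\vee x)\wedge(x\vee z\vee x)$. $S$ is left cancellative if ($x\vee y=x\vee z$ and $x\wedge y=x\wedge z$) $\Rightarrow y=z$. $S$ is a left distributive solution if $r_L(x,y)=(x\wedge y,y\vee x)$ satisfies $(r_L\times\mathrm{id})\circ(\mathrm{id}\times r_L)\circ(r_L\times\mathrm{id})=(\mathrm{id}\times r_L)\circ(r_L\times\mathrm{id})\circ(\mathrm{id}\times r_L)$. *)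

theory Defs
  imports Main
begin

definition skew_lattice :: "'a set \<Rightarrow> ('a \<Rightarrow> 'a \<Rightarrow> 'a) \<Rightarrow> ('a \<Rightarrow> 'a \<Rightarrow> 'a) \<Rightarrow> bool" where
  "skew_lattice S meet join \<longleftrightarrow>
     (\<forall>x\<in>S. \<forall>y\<in>S. meet x y \<in> S \<and> join x y \<in> S) \<and>
     (\<forall>x\<in>S. meet x x = x \<and> join x x = x) \<and>
     (\<forall>x\<in>S. \<forall>y\<in>S. \<forall>z\<in>S. meet (meet x y) z = meet x (meet y z) \<and>
                          join (join x y) z = join x (join y z)) \<and>
     (\<forall>x\<in>S. \<forall>y\<in>S. meet x (join x y) = x \<and> join x (meet x y) = x \<and>
                    join (meet x y) y = y \<and> meet (join x y) y = y)"

definition skew_distributive :: "'a set \<Rightarrow> ('a \<Rightarrow> 'a \<Rightarrow> 'a) \<Rightarrow> ('a \<Rightarrow> 'a \<Rightarrow> 'a) \<Rightarrow> bool" where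
  "skew_distributive S meet join \<longleftrightarrow>
     (\<forall>x\<in>S. \<forall>y\<in>S. \<forall>z\<in>S.
        meet (meet x (join y z)) x = join (meet (meet x y) x) (meet (meet x z) x) \<and>
        join (join x (meet y z)) x = meet (join (join x y) x) (join (join x z) x))"

definition left_cancellative :: "'a set \<Rightarrow> ('a \<Rightarrow> 'a \<Rightarrow> 'a) \<Rightarrow> ('a \<Rightarrow> 'a \<Rightarrow> 'a) \<Rightarrow> bool" where
  "left_cancellative S meet join \<longleftrightarrow>
     (\<forall>x\<in>S. \<forall>y\<in>S. \<forall>z\<in>S. join x y = join x z \<and> meet x y = meet x z \<longrightarrow> y = z)"

definition r_L :: "('a \<Rightarrow> 'a \<Rightarrow> 'a) \<Rightarrow> ('a \<Rightarrow> 'a \<Rightarrow> 'a) \<Rightarrow> 'a \<times> 'a \<Rightarrow> 'a \<times> 'a" where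
  "r_L meet join p = (meet (fst p) (snd p), join (snd p) (fst p))"

definition r12 :: "('a \<times> 'a \<Rightarrow> 'a \<times> 'a) \<Rightarrow> 'a \<times> 'a \<times> 'a \<Rightarrow> 'a \<times> 'a \<times> 'a" where
  "r12 r t = (case t of (x, y, z) \<Rightarrow> (case r (x, y) of (u, v) \<Rightarrow> (u, v, z)))"

definition r23 :: "('a \<times> 'a \<Rightarrow> 'a \<times> 'a) \<Rightarrow> 'a \<times> 'a \<times> 'a \<Rightarrow> 'a \<times> 'a \<times> 'a" where
  "r23 r t = (case t of (x, y, z) \<Rightarrow> (case r (y, z) of (v, w) \<Rightarrow> (x, v, w)))"

definition braided_on :: "'a set \<Rightarrow> ('a \<times> 'a \<Rightarrow> 'a \<times> 'a) \<Rightarrow> bool" where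
  "braided_on S r \<longleftrightarrow>
     (\<forall>x\<in>S. \<forall>y\<in>S. \<forall>z\<in>S.
        (r12 r \<circ> r23 r \<circ> r12 r) (x, y, z) = (r23 r \<circ> r12 r \<circ> r23 r) (x, y, z))"

definition left_distributive_solution :: "'a set \<Rightarrow> ('a \<Rightarrow> 'a \<Rightarrow> 'a) \<Rightarrow> ('a \<Rightarrow> 'a \<Rightarrow> 'a) \<Rightarrow> bool" where
  "left_distributive_solution S meet join \<longleftrightarrow> braided_on S (r_L meet join)"

end

(*
  Only the middle components of the braid equation differ, so it amounts to one identity, which is
  invariant under exchanging meet and join, as are distributivity and left cancellation.  The
  relation R (x meet y = y, y meet x = x) is a congruence with left-handed quotient, and the dual
  construction gives the quotient by the other half L of Green's relation D.  Since R and L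
  intersect in equality, identities can be checked in these two quotients, and hence in
  left-handed skew lattices.  If the lattice is distributive, left cancellation also
  passes to the quotient: the elements y and z to be identified are then D-related, and z meet y
  is R-related to z and L-related to y.

  In the left-handed case, with e = b join a, replacing b and c by their meets with e turns the
  identity into c join (a meet b) = (c join a) meet (c join b), where a and b are complements
  in e and c lies below e.  It then follows by repeated left cancellation.
*)
theory Submission
  imports Defs
begin

section \<open>Reduction to the middle component of the braid equation\<close>

definition braid_identity :: "'a set \<Rightarrow> ('a \<Rightarrow> 'a \<Rightarrow> 'a) \<Rightarrow> ('a \<Rightarrow> 'a \<Rightarrow> 'a) \<Rightarrow> bool" where
  "braid_identity S meet join \<longleftrightarrow>
     (\<forall>x\<in>S. \<forall>y\<in>S. \<forall>z\<in>S.
        join (meet (join y x) z) (meet x y) = meet (join (meet y z) x) (join z y))"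

definition left_handed :: "'a set \<Rightarrow> ('a \<Rightarrow> 'a \<Rightarrow> 'a) \<Rightarrow> ('a \<Rightarrow> 'a \<Rightarrow> 'a) \<Rightarrow> bool" where
  "left_handed S meet join \<longleftrightarrow>
     (\<forall>x\<in>S. \<forall>y\<in>S. meet (meet x y) x = meet x y \<and> join (join x y) x = join y x)"

lemma left_distributive_solution_iff:
  assumes "skew_lattice S meet join"
  shows "left_distributive_solution S meet join \<longleftrightarrow> braid_identity S meet join"
proof -
  have "(r12 (r_L meet join) \<circ> r23 (r_L meet join) \<circ> r12 (r_L meet join)) (x, y, z) =
          (r23 (r_L meet join) \<circ> r12 (r_L meet join) \<circ> r23 (r_L meet join)) (x, y, z) \<longleftrightarrow>
        join (meet (join y x) z) (meet x y) = meet (join (meet y z) x) (join z y)"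
    if [simp]: "x \<in> S" "y \<in> S" "z \<in> S" for x y z
  proof -
    have cl: "\<And>x y. x \<in> S \<Longrightarrow> y \<in> S \<Longrightarrow> meet x y \<in> S \<and> join x y \<in> S"
      and assoc: "\<And>x y z. x \<in> S \<Longrightarrow> y \<in> S \<Longrightarrow> z \<in> S \<Longrightarrow>
        meet (meet x y) z = meet x (meet y z) \<and> join (join x y) z = join x (join y z)"
      and abs: "\<And>x y. x \<in> S \<Longrightarrow> y \<in> S \<Longrightarrow> meet x (join x y) = x \<and> join x (meet x y) = x"
      using assms by (simp_all add: skew_lattice_def)
    have "meet (meet x y) (meet (join y x) z) = meet x (meet (meet y (join y x)) z)"
      using assoc cl by simp
    then have "meet (meet x y) (meet (join y x) z) = meet x (meet y z)"
      using abs by simp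
    moreover have "join (join z y) (join (meet y z) x) = join z (join (join y (meet y z)) x)"
      using assoc cl by simp
    then have "join (join z y) (join (meet y z) x) = join z (join y x)"
      using abs by simp
    ultimately show ?thesis
      by (simp add: r12_def r23_def r_L_def)
  qed
  then show ?thesis
    by (simp add: left_distributive_solution_def braided_on_def braid_identity_def del: o_apply)
qed

lemma skew_lattice_dual: "skew_lattice S meet join \<Longrightarrow> skew_lattice S join meet"
  by (simp add: skew_lattice_def)

lemma skew_distributive_dual: "skew_distributive S meet join \<longleftrightarrow> skew_distributive S join meet"
  by (auto simp: skew_distributive_def)

lemma left_cancellative_dual: "left_cancellative S meet join \<longleftrightarrow> left_cancellative S join meet"
  by (auto simp: left_cancellative_def)

lemma left_cancelD:
  "left_cancellative UNIV meet join \<Longrightarrow> join x y = join x z \<Longrightarrow> meet x y = meet x z \<Longrightarrow> y = z"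
  unfolding left_cancellative_def by blast

text \<open>Exchanging the operations turns the instance at \<open>x\<close>, \<open>y\<close>,
  \<open>z\<close> into the one at \<open>z\<close>, \<open>y\<close>, \<open>x\<close> with its
  sides swapped.\<close>

lemma braid_identity_dual: "braid_identity S meet join \<longleftrightarrow> braid_identity S join meet"
  unfolding braid_identity_def by metis

section \<open>Extending the operations to the whole type\<close>

text \<open>The complement of \<open>S\<close> becomes a left-zero band placed below \<open>S\<close>.  This preserves all the
  properties involved and lets equational reasoning proceed without membership conditions.\<close>

definition bottom_meet :: "'a set \<Rightarrow> ('a \<Rightarrow> 'a \<Rightarrow> 'a) \<Rightarrow> 'a \<Rightarrow> 'a \<Rightarrow> 'a" where
  "bottom_meet S f x y = (if x \<in> S then if y \<in> S then f x y else y else x)"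

definition bottom_join :: "'a set \<Rightarrow> ('a \<Rightarrow> 'a \<Rightarrow> 'a) \<Rightarrow> 'a \<Rightarrow> 'a \<Rightarrow> 'a" where
  "bottom_join S f x y = (if y \<in> S then if x \<in> S then f x y else y else if x \<in> S then x else y)"

lemma skew_lattice_bottom:
  assumes "skew_lattice S meet join"
  shows "skew_lattice UNIV (bottom_meet S meet) (bottom_join S join)"
  using assms by (auto simp: skew_lattice_def bottom_meet_def bottom_join_def)

lemma left_handed_bottom:
  assumes "skew_lattice S meet join"
  shows "left_handed UNIV (bottom_meet S meet) (bottom_join S join) \<longleftrightarrow> left_handed S meet join"
  using assms by (auto simp: skew_lattice_def left_handed_def bottom_meet_def bottom_join_def)

lemma skew_distributive_bottom:
  assumes "skew_lattice S meet join"
  shows "skew_distributive UNIV (bottom_meet S meet) (bottom_join S join) \<longleftrightarrow>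
    skew_distributive S meet join"
  using assms by (auto simp: skew_lattice_def skew_distributive_def bottom_meet_def bottom_join_def)

lemma left_cancellative_bottom:
  assumes "skew_lattice S meet join"
  shows "left_cancellative UNIV (bottom_meet S meet) (bottom_join S join) \<longleftrightarrow>
    left_cancellative S meet join"
proof
  assume L: "left_cancellative UNIV (bottom_meet S meet) (bottom_join S join)"
  show "left_cancellative S meet join"
    unfolding left_cancellative_def
  proof (intro ballI impI)
    fix x y z
    assume "x \<in> S" "y \<in> S" "z \<in> S" "join x y = join x z \<and> meet x y = meet x z"
    then show "y = z"
      using L[unfolded left_cancellative_def, rule_format, of x y z]
      by (simp add: bottom_meet_def bottom_join_def)
  qed
next
  assume L: "left_cancellative S meet join"
  \<comment> \<open>Closure excludes the mixed case of \<open>x\<close> in \<open>S\<close> with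
    exactly one of \<open>y\<close>, \<open>z\<close> in \<open>S\<close>: one of the two meets lies
    in \<open>S\<close> and the other does not. For \<open>x\<close> outside \<open>S\<close> the
    two joins are \<open>y\<close> and \<open>z\<close> themselves.\<close>
  have cl: "meet x y \<in> S" "join x y \<in> S" if "x \<in> S" "y \<in> S" for x y
    using assms that by (auto simp: skew_lattice_def)
  show "left_cancellative UNIV (bottom_meet S meet) (bottom_join S join)"
    unfolding left_cancellative_def
  proof (intro ballI impI, elim conjE)
    fix x y z
    assume "bottom_join S join x y = bottom_join S join x z"
      "bottom_meet S meet x y = bottom_meet S meet x z"
    then show "y = z"
      using L[unfolded left_cancellative_def, rule_format, of x y z] cl[of x y] cl[of x z]
      by (auto simp: bottom_meet_def bottom_join_def split: if_split_asm)
  qed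
qed

lemma braid_identity_bottom:
  assumes "skew_lattice S meet join"
  shows "braid_identity UNIV (bottom_meet S meet) (bottom_join S join) \<longleftrightarrow>
    braid_identity S meet join"
  using assms by (auto simp: skew_lattice_def braid_identity_def bottom_meet_def bottom_join_def)

locale total_skew_lattice =
  fixes meet :: "'a \<Rightarrow> 'a \<Rightarrow> 'a" (infixl "\<sqinter>" 70)
    and join :: "'a \<Rightarrow> 'a \<Rightarrow> 'a" (infixl "\<squnion>" 65)
  assumes skew_lattice_UNIV: "skew_lattice UNIV (\<sqinter>) (\<squnion>)"
begin

lemma meet_assoc: "x \<sqinter> y \<sqinter> z = x \<sqinter> (y \<sqinter> z)"
  and join_assoc: "x \<squnion> y \<squnion> z = x \<squnion> (y \<squnion> z)"
  and meet_idem [simp]: "x \<sqinter> x = x"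
  and join_idem [simp]: "x \<squnion> x = x"
  and meet_join_absorb [simp]: "x \<sqinter> (x \<squnion> y) = x"
  and join_meet_absorb [simp]: "x \<squnion> (x \<sqinter> y) = x"
  and meet_join_absorb_right [simp]: "(x \<sqinter> y) \<squnion> y = y"
  and join_meet_absorb_right [simp]: "(x \<squnion> y) \<sqinter> y = y"
  using skew_lattice_UNIV by (simp_all add: skew_lattice_def)

lemma meet_left_idem [simp]: "x \<sqinter> (x \<sqinter> y) = x \<sqinter> y"
  and join_left_idem [simp]: "x \<squnion> (x \<squnion> y) = x \<squnion> y"
  by (simp_all flip: meet_assoc join_assoc)

lemma join_eq_right_iff: "x \<squnion> y = y \<longleftrightarrow> x \<sqinter> y = x"
  by (metis meet_join_absorb meet_join_absorb_right)

lemma join_eq_left_iff: "x \<squnion> y = x \<longleftrightarrow> x \<sqinter> y = y"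
  by (metis join_meet_absorb join_meet_absorb_right)

lemma total_skew_lattice_dual: "total_skew_lattice (\<squnion>) (\<sqinter>)"
  using skew_lattice_UNIV by (simp add: total_skew_lattice_def skew_lattice_dual)

end

section \<open>The left-handed case\<close>

locale total_left_handed_skew_lattice = total_skew_lattice +
  assumes left_handed_UNIV: "left_handed UNIV (\<sqinter>) (\<squnion>)"
begin

lemma meet_left_handed [simp]: "x \<sqinter> (y \<sqinter> x) = x \<sqinter> y"
  and join_left_handed [simp]: "x \<squnion> (y \<squnion> x) = y \<squnion> x"
  using left_handed_UNIV by (simp_all add: left_handed_def meet_assoc join_assoc)

lemma meet_join_absorb_left_handed [simp]: "x \<sqinter> (y \<squnion> x) = x"
  by (metis join_meet_absorb_right meet_idem meet_left_handed)

lemma join_meet_absorb_left_handed [simp]: "(x \<sqinter> y) \<squnion> x = x"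
  by (metis join_left_handed join_meet_absorb)

lemma meet_join_absorb_inner [simp]: "(y \<sqinter> (x \<sqinter> z)) \<squnion> x = x"
  by (simp add: join_eq_right_iff meet_assoc)

section \<open>From the braid identity to distributivity and left cancellation\<close>

text \<open>If the first factor already lies above the joined element, the law is an instance of the
  braid identity; this is \<open>A\<close>. In general the left side is first met with the larger
  \<open>y \<squnion> (x \<squnion> z)\<close>, and \<open>A\<close> together with one braid
  instance reduces the result to \<open>A\<close> again.\<close>

lemma braid_imp_join_distrib:
  assumes "braid_identity UNIV (\<sqinter>) (\<squnion>)"
  shows "(x \<sqinter> y) \<squnion> z = (x \<squnion> z) \<sqinter> (y \<squnion> z)"
proof -
  have br: "((y \<squnion> x) \<sqinter> z) \<squnion> (x \<sqinter> y) = ((y \<sqinter> z) \<squnion> x) \<sqinter> (z \<squnion> y)" for x y z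
    using assms by (simp add: braid_identity_def)
  have A: "((z \<squnion> x) \<sqinter> y) \<squnion> x = (z \<squnion> x) \<sqinter> (y \<squnion> x)" for x y z
  proof -
    have "(x \<sqinter> y) \<squnion> (z \<squnion> x) = z \<squnion> x"
      by (metis join_eq_right_iff meet_assoc meet_join_absorb_left_handed meet_left_handed)
    then show ?thesis
      using br[where y=x and x="z \<squnion> x" and z=y] by simp
  qed
  have "((x \<sqinter> y) \<squnion> z) \<sqinter> (y \<squnion> (x \<squnion> z)) = (((x \<squnion> z) \<sqinter> y) \<squnion> (z \<sqinter> x)) \<squnion> z"
    using A[of "x \<sqinter> y" z "y \<squnion> x"] br[where x=z and y=x and z=y] by (metis A join_assoc)
  also have "\<dots> = ((x \<squnion> z) \<sqinter> y) \<squnion> z"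
    by (simp add: join_assoc)
  also have "\<dots> = (x \<squnion> z) \<sqinter> (y \<squnion> z)"
    by (rule A)
  also have "((x \<sqinter> y) \<squnion> z) \<sqinter> (y \<squnion> (x \<squnion> z)) = (x \<sqinter> y) \<squnion> z"
    by (metis join_assoc join_meet_absorb meet_join_absorb_left_handed)
  finally show ?thesis .
qed

text \<open>The braid identity at \<open>x\<close>, \<open>z\<close>, \<open>x \<sqinter> y\<close>
  pulls \<open>x\<close> out of the join, leaving
  \<open>x \<sqinter> ((x \<sqinter> y) \<squnion> z)\<close>. The other distributive law and
  absorption remove the inner \<open>x\<close>.\<close>

lemma braid_imp_meet_distrib:
  assumes "braid_identity UNIV (\<sqinter>) (\<squnion>)"
  shows "x \<sqinter> (y \<squnion> z) = (x \<sqinter> y) \<squnion> (x \<sqinter> z)"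
proof -
  have "(x \<sqinter> y) \<squnion> (x \<sqinter> z) = ((z \<squnion> x) \<sqinter> (x \<sqinter> y)) \<squnion> (x \<sqinter> z)"
    by (simp flip: meet_assoc)
  also have "\<dots> = x \<sqinter> ((x \<sqinter> y) \<squnion> z)"
    using assms[unfolded braid_identity_def, rule_format, of x z "x \<sqinter> y"]
    by simp
  also have "\<dots> = x \<sqinter> (y \<squnion> z)"
    by (metis braid_imp_join_distrib[OF assms] meet_assoc meet_join_absorb)
  finally show ?thesis ..
qed

text \<open>Left-handedness drops the last factor of a meet sandwich and the first term of a join
  sandwich, so both laws become one-sided.\<close>

lemma skew_distributive_iff:
  "skew_distributive UNIV (\<sqinter>) (\<squnion>) \<longleftrightarrow>
    (\<forall>x y z. x \<sqinter> (y \<squnion> z) = (x \<sqinter> y) \<squnion> (x \<sqinter> z)) \<and>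
    (\<forall>x y z. (x \<sqinter> y) \<squnion> z = (x \<squnion> z) \<sqinter> (y \<squnion> z))"
  by (simp add: skew_distributive_def meet_assoc join_assoc) blast

text \<open>By \<open>swap\<close>, the join and meet of \<open>a\<close> with \<open>b\<close>
  determine \<open>b \<sqinter> a\<close>, so \<open>b \<sqinter> a = c \<sqinter> a\<close>. By
  \<open>exch\<close>, \<open>b = c \<squnion> (b \<sqinter> a)\<close>, which then collapses to
  \<open>c\<close> by absorption.\<close>

lemma braid_imp_left_cancellative:
  assumes "braid_identity UNIV (\<sqinter>) (\<squnion>)"
  shows "left_cancellative UNIV (\<sqinter>) (\<squnion>)"
  unfolding left_cancellative_def
proof (intro ballI impI, elim conjE)
  fix a b c
  assume join_eq: "a \<squnion> b = a \<squnion> c" and meet_eq: "a \<sqinter> b = a \<sqinter> c"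
  have br: "((y \<squnion> x) \<sqinter> z) \<squnion> (x \<sqinter> y) = ((y \<sqinter> z) \<squnion> x) \<sqinter> (z \<squnion> y)" for x y z
    using assms by (simp add: braid_identity_def)
  have swap: "(x \<squnion> y) \<sqinter> (x \<sqinter> y) = y \<sqinter> x" for x y
  proof -
    have "((x \<squnion> y) \<sqinter> x) \<squnion> (y \<sqinter> x) = (x \<squnion> y) \<sqinter> x"
      using br[where x=y and y=x and z=x] by simp
    then have "(x \<squnion> y) \<sqinter> x \<sqinter> (y \<sqinter> x) = y \<sqinter> x"
      using join_eq_left_iff by blast
    then show ?thesis
      by (simp add: meet_assoc)
  qed
  have exch: "w \<squnion> (v \<sqinter> a) = v"
    if "a \<squnion> v = a \<squnion> w" "a \<sqinter> v = a \<sqinter> w" for v w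
  proof -
    have "w \<squnion> a = v \<squnion> a"
      using that by (metis join_assoc join_left_handed)
    then show ?thesis
      using br[where x=v and y=a and z=w] that by (metis join_meet_absorb_right meet_join_absorb meet_join_absorb_right)
  qed
  have "b \<sqinter> a = c \<sqinter> a"
    using swap join_eq meet_eq by metis
  then show "b = c"
    using exch[of b c] join_eq meet_eq by (metis join_meet_absorb)
qed

section \<open>From distributivity and left cancellation to the braid identity\<close>

text \<open>The elements \<open>x \<squnion> (y \<sqinter> x)\<close> and \<open>x\<close> have the
  same join and the same meet with \<open>y\<close>, hence are equal. So
  \<open>x \<sqinter> (y \<sqinter> x)\<close> is \<open>y \<sqinter> x\<close>, while
  left-handedness makes it \<open>x \<sqinter> y\<close>.\<close>

lemma meet_commute_of_join_commute:
  assumes "skew_distributive UNIV (\<sqinter>) (\<squnion>)" "left_cancellative UNIV (\<sqinter>) (\<squnion>)"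
    and comm: "x \<squnion> y = y \<squnion> x"
  shows "x \<sqinter> y = y \<sqinter> x"
proof -
  have "y \<squnion> (x \<squnion> (y \<sqinter> x)) = y \<squnion> x"
    by (metis comm join_assoc join_meet_absorb)
  moreover have "y \<sqinter> (x \<squnion> (y \<sqinter> x)) = y \<sqinter> x"
    using assms(1) by (simp add: skew_distributive_iff)
  ultimately have "x \<squnion> (y \<sqinter> x) = x"
    by (metis left_cancelD[OF assms(2)])
  then show ?thesis
    by (metis join_eq_left_iff meet_left_handed)
qed

text \<open>Thus \<open>e \<sqinter> x = x\<close> alone expresses that \<open>x\<close> lies below
  \<open>e\<close> in the natural order.\<close>

lemma meet_absorb_swap: "e \<sqinter> x = x \<Longrightarrow> x \<sqinter> e = x"
  by (metis meet_idem meet_left_handed)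

text \<open>Brings a common term to the left of a join, where it can be cancelled:
  \<open>e \<squnion> y = e\<close> gives \<open>y \<squnion> (x \<squnion> y) = e\<close>, and
  left-handedness drops the first \<open>y\<close>.\<close>

lemma join_swap_of_meet: "y \<squnion> x = e \<Longrightarrow> e \<sqinter> y = y \<Longrightarrow> x \<squnion> y = e"
  by (metis join_assoc join_eq_left_iff join_left_handed)

text \<open>Left cancellation of \<open>a\<close>: both sides have join
  \<open>c \<squnion> a\<close> and meet \<open>(a \<sqinter> c) \<squnion> (a \<sqinter> b)\<close>
  with it.\<close>

lemma join_distrib_complements:
  assumes D: "skew_distributive UNIV (\<sqinter>) (\<squnion>)" and C: "left_cancellative UNIV (\<sqinter>) (\<squnion>)"
    and e: "a \<squnion> b = e" "b \<squnion> a = e" and c: "e \<sqinter> c = c"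
  shows "(c \<squnion> a) \<sqinter> (c \<squnion> b) = ((c \<squnion> a) \<sqinter> c) \<squnion> (a \<sqinter> b)"
proof -
  have dl: "x \<sqinter> (y \<squnion> z) = (x \<sqinter> y) \<squnion> (x \<sqinter> z)"
    and dr: "(x \<sqinter> y) \<squnion> z = (x \<squnion> z) \<sqinter> (y \<squnion> z)" for x y z
    using D unfolding skew_distributive_iff by blast+
  define p q c1 where "p = c \<squnion> a" and "q = c \<squnion> b" and "c1 = p \<sqinter> c"
  have ce: "c \<squnion> e = e"
    using c meet_absorb_swap join_eq_right_iff by blast
  have ap: "a \<sqinter> p = a" and pa: "p \<sqinter> a = a"
    by (simp_all add: p_def)
  have ep: "e \<sqinter> p = p"
    using c e by (metis dl join_meet_absorb_right p_def)
  have qa: "q \<squnion> a = e"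
    using ce e by (simp add: q_def join_assoc)
  have "c1 \<squnion> a = p"
    unfolding c1_def by (simp add: dr p_def join_assoc)
  then have ac1: "a \<squnion> c1 = p"
    by (rule join_swap_of_meet) (simp add: c1_def)
  have "(p \<sqinter> q) \<squnion> a = p"
    using ep meet_absorb_swap qa by (simp add: dr) (simp add: p_def join_assoc)
  then have "a \<squnion> (p \<sqinter> q) = p"
    by (rule join_swap_of_meet) simp
  moreover have "a \<squnion> (c1 \<squnion> (a \<sqinter> b)) = p"
    by (metis ac1 join_assoc join_eq_left_iff meet_assoc pa)
  moreover have "a \<sqinter> (p \<sqinter> q) = a \<sqinter> (c1 \<squnion> (a \<sqinter> b))"
    by (metis ap c1_def dl meet_assoc meet_left_idem q_def)
  ultimately have "p \<sqinter> q = c1 \<squnion> (a \<sqinter> b)"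
    by (metis left_cancelD[OF C])
  then show ?thesis
    by (simp add: p_def q_def c1_def)
qed

text \<open>Being below \<open>e\<close>, the element \<open>p \<squnion> q\<close> is absorbed by
  \<open>e\<close> in \<open>e \<squnion> (p \<squnion> q)\<close>. Written as
  \<open>a \<squnion> (c \<squnion> b)\<close>, it also absorbs \<open>a\<close> and
  \<open>b\<close> joined on its left, hence \<open>e\<close>.\<close>

lemma join_complements_eq:
  assumes e: "a \<squnion> b = e" and ep: "e \<sqinter> p = p" and eq: "e \<sqinter> q = q" and "p \<squnion> q = a \<squnion> (c \<squnion> b)"
    and D: "skew_distributive UNIV (\<sqinter>) (\<squnion>)"
  shows "p \<squnion> q = e"
proof -
  have "e \<sqinter> (p \<squnion> q) = p \<squnion> q"
    using D ep eq unfolding skew_distributive_iff by metis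
  then have "e = e \<squnion> (p \<squnion> q)"
    using join_eq_left_iff by metis
  also have "\<dots> = p \<squnion> q"
    using assms by (metis join_assoc join_left_handed)
  finally show ?thesis ..
qed

text \<open>The element \<open>d\<close> has the same left meets with \<open>a\<close> and
  \<open>b\<close> as \<open>c\<close>, and it join-commutes with \<open>a\<close>, so it also
  meet-commutes with \<open>a\<close>. To carry this over to \<open>c\<close>, the element
  \<open>b\<close> is cancelled from \<open>c \<sqinter> a\<close> and
  \<open>a \<sqinter> c\<close>; that their joins with \<open>b\<close> agree follows by cancelling
  \<open>a\<close>.\<close>

lemma meet_commute_of_equal_meets:
  assumes D: "skew_distributive UNIV (\<sqinter>) (\<squnion>)" and C: "left_cancellative UNIV (\<sqinter>) (\<squnion>)"
    and e: "a \<squnion> b = e" "b \<squnion> a = e" and c: "e \<sqinter> c = c"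
    and d: "(c \<squnion> a) \<sqinter> c = d" "(c \<squnion> b) \<sqinter> c = d"
  shows "c \<sqinter> a = a \<sqinter> c \<and> a \<sqinter> d = a \<sqinter> c \<and> d \<sqinter> a = a \<sqinter> c"
proof -
  have dl: "x \<sqinter> (y \<squnion> z) = (x \<sqinter> y) \<squnion> (x \<sqinter> z)"
    and dr: "(x \<sqinter> y) \<squnion> z = (x \<squnion> z) \<sqinter> (y \<squnion> z)" for x y z
    using D unfolding skew_distributive_iff by blast+
  have eb: "e \<sqinter> b = b" and ea: "e \<sqinter> a = a"
    using e by (metis join_meet_absorb_right)+
  have ad: "a \<sqinter> d = a \<sqinter> c"
    by (metis d(1) meet_assoc meet_join_absorb_left_handed)
  have bd: "b \<sqinter> d = b \<sqinter> c"
    by (metis d(2) meet_assoc meet_join_absorb_left_handed)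
  have da_join: "d \<squnion> a = c \<squnion> a"
    using d(1) by (metis dr join_assoc join_idem meet_idem)
  have "a \<squnion> d = c \<squnion> a"
    using da_join by (rule join_swap_of_meet) (metis d(1) meet_left_idem)
  then have da: "d \<sqinter> a = a \<sqinter> c"
    using meet_commute_of_join_commute[OF D C, of d a] da_join ad by simp
  have db_join: "d \<squnion> b = c \<squnion> b"
    using d(2) by (metis dr join_assoc join_idem meet_idem)
  define q where "q = c \<squnion> b"
  have eq: "e \<sqinter> q = q"
    using eb c by (simp add: q_def dl)
  have "(a \<sqinter> c) \<squnion> b = q"
    using ad db_join e eq dr q_def by metis
  then have bac: "b \<squnion> (a \<sqinter> c) = q"
    by (rule join_swap_of_meet) (metis d(2) da meet_assoc meet_left_idem q_def)
  have bca: "b \<squnion> (c \<sqinter> a) = q"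
  proof -
    have "a \<squnion> q = e"
      using join_complements_eq[OF e(1) ea eq _ D] q_def by blast
    moreover have "a \<squnion> (b \<squnion> (c \<sqinter> a)) = e"
      by (metis c e(1) join_assoc join_eq_left_iff meet_assoc)
    moreover have "a \<sqinter> (b \<squnion> (c \<sqinter> a)) = a \<sqinter> q"
      by (simp add: dl flip: bac)
    ultimately show ?thesis
      by (metis left_cancelD[OF C])
  qed
  \<comment> \<open>Behind \<open>b\<close>, the element \<open>c\<close> may be replaced by
    \<open>d\<close>, which commutes with \<open>a\<close>.\<close>
  have "b \<sqinter> (c \<sqinter> a) = b \<sqinter> (a \<sqinter> c)"
    by (metis bd da meet_assoc)
  then have "c \<sqinter> a = a \<sqinter> c"
    using bac bca by (metis left_cancelD[OF C])
  then show ?thesis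
    using ad da by simp
qed

text \<open>Since \<open>p \<sqinter> q = d \<squnion> (a \<sqinter> b)\<close>, it suffices that
  \<open>c = d\<close>. Cancelling \<open>a \<sqinter> b\<close> yields
  \<open>q \<sqinter> c = d\<close>; then \<open>c\<close> and \<open>d\<close> have the same meets
  with \<open>a\<close> and \<open>b\<close>, hence with their join \<open>e\<close>, which lies
  above both.\<close>

lemma join_distrib_of_commute:
  assumes D: "skew_distributive UNIV (\<sqinter>) (\<squnion>)" and C: "left_cancellative UNIV (\<sqinter>) (\<squnion>)"
    and e: "a \<squnion> b = e" "b \<squnion> a = e" and c: "e \<sqinter> c = c"
    and comm: "c \<squnion> (a \<sqinter> b) = (a \<sqinter> b) \<squnion> c"
  shows "c \<squnion> (a \<sqinter> b) = (c \<squnion> a) \<sqinter> (c \<squnion> b)"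
proof -
  have dl: "x \<sqinter> (y \<squnion> z) = (x \<sqinter> y) \<squnion> (x \<sqinter> z)" for x y z
    using D unfolding skew_distributive_iff by blast
  define p q d where "p = c \<squnion> a" and "q = c \<squnion> b" and "d = p \<sqinter> c"
  have ab: "a \<sqinter> b = b \<sqinter> a"
    using meet_commute_of_join_commute[OF D C] e by simp
  have eb: "e \<sqinter> b = b" and ea: "e \<sqinter> a = a"
    using e by (metis join_meet_absorb_right)+
  have ep: "e \<sqinter> p = p" and eq: "e \<sqinter> q = q"
    using ea eb c by (simp_all add: dl p_def q_def)
  have "p \<squnion> q = e"
    by (rule join_complements_eq[OF e(1) ep eq _ D, of c]) (metis join_assoc join_left_handed p_def q_def)
  moreover have "q \<squnion> p = e"
    by (rule join_complements_eq[OF e(2) eq ep _ D, of c]) (metis join_assoc join_left_handed p_def q_def)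
  ultimately have "p \<sqinter> q = q \<sqinter> p"
    using meet_commute_of_join_commute[OF D C] by simp
  \<comment> \<open>The second equation is the first with \<open>a\<close> and \<open>b\<close>
    exchanged; it describes the same element because both meets commute.\<close>
  then have V: "p \<sqinter> q = d \<squnion> (a \<sqinter> b)" "p \<sqinter> q = (q \<sqinter> c) \<squnion> (a \<sqinter> b)"
    using join_distrib_complements[OF D C e c] join_distrib_complements[OF D C e(2,1) c] ab
    by (simp_all add: p_def q_def d_def)
  have pab: "p \<sqinter> (a \<sqinter> b) = a \<sqinter> b"
    by (metis join_meet_absorb_right meet_assoc p_def)
  have qab: "q \<sqinter> (a \<sqinter> b) = a \<sqinter> b"
    by (metis ab join_meet_absorb_right meet_assoc q_def)
  \<comment> \<open>Here \<open>comm\<close> enters: meeting it with \<open>p\<close> on the left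
    shows that \<open>d\<close> join-commutes with \<open>a \<sqinter> b\<close>, and meeting it
    with \<open>q\<close> does the same for \<open>q \<sqinter> c\<close>.\<close>
  have "(a \<sqinter> b) \<squnion> d = (a \<sqinter> b) \<squnion> (q \<sqinter> c)"
    using V comm pab qab by (metis d_def dl)
  moreover have "(a \<sqinter> b) \<sqinter> d = (a \<sqinter> b) \<sqinter> (q \<sqinter> c)"
    by (metis d_def meet_absorb_swap meet_assoc pab qab)
  ultimately have dq: "q \<sqinter> c = d"
    by (metis left_cancelD[OF C])
  have a: "c \<sqinter> a = a \<sqinter> c \<and> a \<sqinter> d = a \<sqinter> c \<and> d \<sqinter> a = a \<sqinter> c"
    by (rule meet_commute_of_equal_meets[OF D C e c]) (use dq in \<open>simp_all add: p_def q_def d_def\<close>)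
  have b: "c \<sqinter> b = b \<sqinter> c \<and> b \<sqinter> d = b \<sqinter> c \<and> d \<sqinter> b = b \<sqinter> c"
    by (rule meet_commute_of_equal_meets[OF D C e(2,1) c]) (use dq in \<open>simp_all add: p_def q_def d_def\<close>)
  have "c = c \<sqinter> e"
    using c meet_absorb_swap by simp
  also have "\<dots> = d \<sqinter> e"
    using a b by (simp add: dl flip: e(1))
  also have "\<dots> = d"
    by (rule meet_absorb_swap) (metis d_def ep meet_assoc)
  finally show ?thesis
    using V by (simp add: p_def q_def)
qed

lemma join_distrib_of_join_eq:
  assumes D: "skew_distributive UNIV (\<sqinter>) (\<squnion>)" and C: "left_cancellative UNIV (\<sqinter>) (\<squnion>)"
    and e: "a \<squnion> b = e" "b \<squnion> a = e" and c: "e \<sqinter> c = c"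
  shows "c \<squnion> (a \<sqinter> b) = (c \<squnion> a) \<sqinter> (c \<squnion> b)"
proof -
  have dl: "x \<sqinter> (y \<squnion> z) = (x \<sqinter> y) \<squnion> (x \<sqinter> z)"
    and dr: "(x \<sqinter> y) \<squnion> z = (x \<squnion> z) \<sqinter> (y \<squnion> z)" for x y z
    using D unfolding skew_distributive_iff by blast+
  \<comment> \<open>Replacing \<open>c\<close> by \<open>g \<sqinter> c\<close> changes neither side and makes it join-commute with \<open>a \<sqinter> b\<close>.\<close>
  define g c' where "g = c \<squnion> (a \<sqinter> b)" and "c' = g \<sqinter> c"
  have c'ab: "c' \<squnion> (a \<sqinter> b) = g"
    by (simp add: c'_def dr g_def join_assoc)
  have abc': "(a \<sqinter> b) \<squnion> c' = g"
    using c'ab by (rule join_swap_of_meet) (simp add: c'_def)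
  have "g \<squnion> a = c \<squnion> a"
    by (simp add: g_def join_assoc)
  then have c'a: "c' \<squnion> a = c \<squnion> a"
    by (simp add: c'_def dr)
  have "g \<squnion> b = c \<squnion> b"
    by (simp add: g_def join_assoc)
  then have c'b: "c' \<squnion> b = c \<squnion> b"
    by (simp add: c'_def dr)
  have "e \<sqinter> g = g"
    using c e by (metis dl g_def join_meet_absorb_right meet_assoc)
  then have "e \<sqinter> c' = c'"
    by (metis c'_def meet_assoc)
  then have "c' \<squnion> (a \<sqinter> b) = (c' \<squnion> a) \<sqinter> (c' \<squnion> b)"
    using join_distrib_of_commute[OF D C e] c'ab abc' by simp
  then show ?thesis
    using c'ab c'a c'b g_def by simp
qed

lemma braid_of_distributive_cancellative:
  assumes D: "skew_distributive UNIV (\<sqinter>) (\<squnion>)" and C: "left_cancellative UNIV (\<sqinter>) (\<squnion>)"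
  shows "braid_identity UNIV (\<sqinter>) (\<squnion>)"
  unfolding braid_identity_def
proof (intro ballI)
  fix a b c
  have dl: "x \<sqinter> (y \<squnion> z) = (x \<sqinter> y) \<squnion> (x \<sqinter> z)"
    and dr: "(x \<sqinter> y) \<squnion> z = (x \<squnion> z) \<sqinter> (y \<squnion> z)" for x y z
    using D unfolding skew_distributive_iff by blast+
  define e where "e = b \<squnion> a"
  have ea: "e \<squnion> a = e"
    by (simp add: e_def join_assoc)
  have ba: "(e \<sqinter> b) \<squnion> a = e"
    by (simp add: dr ea) (simp add: e_def)
  have "a \<squnion> (e \<sqinter> b) = e"
    using ba by (rule join_swap_of_meet) simp
  then have "(e \<sqinter> c) \<squnion> (a \<sqinter> (e \<sqinter> b)) = ((e \<sqinter> c) \<squnion> a) \<sqinter> ((e \<sqinter> c) \<squnion> (e \<sqinter> b))"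
    using join_distrib_of_join_eq[OF D C _ ba] by simp
  moreover have "a \<sqinter> (e \<sqinter> b) = a \<sqinter> b"
    by (metis e_def meet_assoc meet_join_absorb_left_handed)
  moreover have "((e \<sqinter> c) \<squnion> a) \<sqinter> ((e \<sqinter> c) \<squnion> (e \<sqinter> b)) = e \<sqinter> ((c \<squnion> a) \<sqinter> (c \<squnion> b))"
    by (metis dl dr ea meet_assoc meet_left_handed)
  \<comment> \<open>By distributivity \<open>e \<sqinter> (c \<squnion> a)\<close> is
    \<open>(b \<sqinter> c) \<squnion> a\<close>.\<close>
  ultimately show "((b \<squnion> a) \<sqinter> c) \<squnion> (a \<sqinter> b) = ((b \<sqinter> c) \<squnion> a) \<sqinter> (c \<squnion> b)"
    by (metis dr e_def meet_assoc)
qed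

lemma braid_iff:
  "braid_identity UNIV (\<sqinter>) (\<squnion>) \<longleftrightarrow>
    skew_distributive UNIV (\<sqinter>) (\<squnion>) \<and> left_cancellative UNIV (\<sqinter>) (\<squnion>)"
  using braid_of_distributive_cancellative braid_imp_left_cancellative braid_imp_meet_distrib
    braid_imp_join_distrib skew_distributive_iff by blast

end

text \<open>Stated for a carrier set because it is applied to quotients, whose carriers are sets of
  classes.\<close>

lemma left_handed_braid_iff:
  assumes "skew_lattice S meet join" "left_handed S meet join"
  shows "braid_identity S meet join \<longleftrightarrow>
    skew_distributive S meet join \<and> left_cancellative S meet join"
proof -
  interpret total_left_handed_skew_lattice "bottom_meet S meet" "bottom_join S join"
    by unfold_locales (use assms in \<open>simp_all add: skew_lattice_bottom left_handed_bottom\<close>)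
  show ?thesis
    using braid_iff assms(1)
    by (simp add: braid_identity_bottom skew_distributive_bottom left_cancellative_bottom)
qed

section \<open>The left-handed quotients\<close>

context total_skew_lattice
begin

section \<open>Green's relation R as a congruence\<close>

definition right_rel :: "('a \<times> 'a) set" where
  "right_rel = {(x, y). x \<sqinter> y = y \<and> y \<sqinter> x = x}"

lemma right_rel_iff: "(x, y) \<in> right_rel \<longleftrightarrow> x \<sqinter> y = y \<and> y \<sqinter> x = x"
  by (simp add: right_rel_def)

lemma right_rel_iff_join: "(x, y) \<in> right_rel \<longleftrightarrow> x \<squnion> y = x \<and> y \<squnion> x = y"
  by (simp add: right_rel_iff join_eq_left_iff)

lemma equiv_right_rel: "equiv UNIV right_rel"
proof (rule equivI)
  show "trans right_rel"
    by (rule transI) (metis meet_assoc right_rel_iff)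
qed (auto simp: refl_on_def sym_def right_rel_iff)

text \<open>Absorption writes \<open>y\<close> as a join whose last term is
  \<open>(x \<sqinter> (y \<sqinter> z)) \<squnion> y\<close>, so joining that term once more on the
  right changes nothing.\<close>

lemma join_sandwich: "y \<squnion> ((x \<sqinter> (y \<sqinter> z)) \<squnion> y) = y"
proof -
  have "y = (x \<sqinter> y) \<squnion> y"
    by simp
  also have "\<dots> = (x \<sqinter> y) \<squnion> ((x \<sqinter> y \<sqinter> z) \<squnion> y)"
    by (metis join_assoc join_meet_absorb)
  finally have "y = (x \<sqinter> y) \<squnion> ((x \<sqinter> y \<sqinter> z) \<squnion> y)" .
  then show ?thesis
    by (metis join_assoc join_idem meet_assoc)
qed

text \<open>This makes \<open>right_rel\<close> compatible with meets on the right: meeting both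
  sides with \<open>x\<close> on the right gives \<open>(a \<sqinter> x) \<sqinter> (b \<sqinter> x)
  = b \<sqinter> x\<close>.\<close>

lemma right_rel_meet_swap:
  assumes "(a, b) \<in> right_rel"
  shows "a \<sqinter> (x \<sqinter> b) = b \<sqinter> (x \<sqinter> b)"
proof -
  have ab: "a \<sqinter> b = b" "b \<sqinter> a = a"
    using assms by (simp_all add: right_rel_iff)
  \<comment> \<open>Chosen so that \<open>a = b \<sqinter> s\<close>, while \<open>s\<close>
    disappears in front of \<open>x \<sqinter> b\<close>.\<close>
  define s where "s = a \<squnion> (x \<sqinter> b)"
  have "s \<squnion> a = a"
    using join_sandwich[of a x b] ab by (simp add: s_def join_assoc)
  then have sa: "s \<sqinter> a = s"
    using join_eq_right_iff by blast
  have "a \<sqinter> s = a"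
    by (simp add: s_def)
  then have "b \<sqinter> (s \<sqinter> b) = b"
    using ab by (metis meet_assoc meet_idem)
  then have "b \<sqinter> s = a"
    using ab sa by (metis meet_assoc)
  then have "a \<sqinter> (x \<sqinter> b) = b \<sqinter> (s \<sqinter> (x \<sqinter> b))"
    by (metis meet_assoc)
  also have "\<dots> = b \<sqinter> (x \<sqinter> b)"
    by (simp add: s_def)
  finally show ?thesis .
qed

lemma right_rel_meet:
  assumes "(a, b) \<in> right_rel" "(c, d) \<in> right_rel"
  shows "(a \<sqinter> c, b \<sqinter> d) \<in> right_rel"
proof -
  have "(a \<sqinter> c, b \<sqinter> c) \<in> right_rel" if "(a, b) \<in> right_rel" for a b c
  proof -
    have "(b, a) \<in> right_rel"
      using that by (simp add: right_rel_iff)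
    then show ?thesis
      using that right_rel_meet_swap by (metis meet_assoc meet_idem right_rel_iff)
  qed
  moreover have "(a \<sqinter> c, a \<sqinter> d) \<in> right_rel" if "(c, d) \<in> right_rel" for a c d
  proof -
    have "(d, c) \<in> right_rel"
      using that by (simp add: right_rel_iff)
    then show ?thesis
      using that right_rel_meet_swap by (metis meet_assoc meet_idem right_rel_iff)
  qed
  ultimately show ?thesis
    using assms equiv_right_rel by (meson equivE transE)
qed

lemma right_rel_join_swap:
  assumes "(a, b) \<in> right_rel"
  shows "b \<squnion> (x \<squnion> a) = b \<squnion> (x \<squnion> b)"
proof -
  \<comment> \<open>Exchanging the operations and reversing their arguments gives a skew lattice
    with the same \<open>right_rel\<close>.\<close>
  interpret mirror: total_skew_lattice "\<lambda>x y. y \<squnion> x" "\<lambda>x y. y \<sqinter> x"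
    using skew_lattice_UNIV by unfold_locales (simp add: skew_lattice_def)
  show ?thesis
    using mirror.right_rel_meet_swap[of a b x] assms
    by (simp add: mirror.right_rel_iff right_rel_iff_join join_assoc)
qed

lemma right_rel_join:
  assumes "(a, b) \<in> right_rel" "(c, d) \<in> right_rel"
  shows "(a \<squnion> c, b \<squnion> d) \<in> right_rel"
proof -
  have "(a \<squnion> c, b \<squnion> c) \<in> right_rel" if "(a, b) \<in> right_rel" for a b c
  proof -
    have "(b, a) \<in> right_rel"
      using that by (simp add: right_rel_iff)
    then show ?thesis
      using that right_rel_join_swap by (metis join_assoc join_idem right_rel_iff_join)
  qed
  moreover have "(a \<squnion> c, a \<squnion> d) \<in> right_rel" if "(c, d) \<in> right_rel" for a c d
  proof -
    have "(d, c) \<in> right_rel"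
      using that by (simp add: right_rel_iff)
    then show ?thesis
      using that right_rel_join_swap by (metis join_assoc join_idem right_rel_iff_join)
  qed
  ultimately show ?thesis
    using assms equiv_right_rel by (meson equivE transE)
qed

section \<open>The quotient by R\<close>

definition right_class :: "'a \<Rightarrow> 'a set" where
  "right_class x = right_rel `` {x}"

definition quotient_op :: "('a \<Rightarrow> 'a \<Rightarrow> 'a) \<Rightarrow> 'a set \<Rightarrow> 'a set \<Rightarrow> 'a set" where
  "quotient_op f X Y = right_class (f (SOME x. x \<in> X) (SOME y. y \<in> Y))"

lemma right_class_eq_iff [simp]: "right_class x = right_class y \<longleftrightarrow> (x, y) \<in> right_rel"
  unfolding right_class_def using equiv_right_rel by (simp add: eq_equiv_class_iff)

lemma some_right_class: "(SOME y. y \<in> right_class x, x) \<in> right_rel"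
proof -
  have "x \<in> right_class x"
    by (simp add: right_class_def right_rel_iff)
  then have "(SOME y. y \<in> right_class x) \<in> right_class x"
    by (rule someI)
  then show ?thesis
    by (simp add: right_class_def right_rel_iff)
qed

lemma quotient_meet [simp]:
  "quotient_op (\<sqinter>) (right_class x) (right_class y) = right_class (x \<sqinter> y)"
  by (simp add: quotient_op_def right_rel_meet some_right_class)

lemma quotient_join [simp]:
  "quotient_op (\<squnion>) (right_class x) (right_class y) = right_class (x \<squnion> y)"
  by (simp add: quotient_op_def right_rel_join some_right_class)

abbreviation "quotient_carrier \<equiv> range right_class"
abbreviation "quotient_meet_op \<equiv> quotient_op (\<sqinter>)"
abbreviation "quotient_join_op \<equiv> quotient_op (\<squnion>)"

lemma right_rel_refl [simp]: "(x, x) \<in> right_rel"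
  by (simp add: right_rel_iff)

lemma skew_lattice_quotient: "skew_lattice quotient_carrier quotient_meet_op quotient_join_op"
  by (simp add: skew_lattice_def meet_assoc join_assoc) blast

lemma left_handed_quotient: "left_handed quotient_carrier quotient_meet_op quotient_join_op"
proof -
  have "(x \<sqinter> y \<sqinter> x, x \<sqinter> y) \<in> right_rel" for x y
    by (metis meet_assoc meet_idem right_rel_iff)
  moreover have "(x \<squnion> y \<squnion> x, y \<squnion> x) \<in> right_rel" for x y
    by (metis join_assoc join_idem right_rel_iff_join)
  ultimately show ?thesis
    by (simp add: left_handed_def)
qed

lemma quotient_braid_iff:
  "braid_identity quotient_carrier quotient_meet_op quotient_join_op \<longleftrightarrow>
    skew_distributive quotient_carrier quotient_meet_op quotient_join_op \<and>
    left_cancellative quotient_carrier quotient_meet_op quotient_join_op"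
  by (rule left_handed_braid_iff[OF skew_lattice_quotient left_handed_quotient])

lemma braid_identity_quotient:
  "braid_identity quotient_carrier quotient_meet_op quotient_join_op \<longleftrightarrow>
    (\<forall>x y z. (((y \<squnion> x) \<sqinter> z) \<squnion> (x \<sqinter> y), ((y \<sqinter> z) \<squnion> x) \<sqinter> (z \<squnion> y)) \<in> right_rel)"
  by (simp add: braid_identity_def)

lemma skew_distributive_quotient:
  "skew_distributive quotient_carrier quotient_meet_op quotient_join_op \<longleftrightarrow>
    (\<forall>x y z.
      (x \<sqinter> (y \<squnion> z) \<sqinter> x, (x \<sqinter> y \<sqinter> x) \<squnion> (x \<sqinter> z \<sqinter> x)) \<in> right_rel \<and>
      (x \<squnion> (y \<sqinter> z) \<squnion> x, (x \<squnion> y \<squnion> x) \<sqinter> (x \<squnion> z \<squnion> x)) \<in> right_rel)"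
  by (simp add: skew_distributive_def)

lemma left_cancellative_quotient:
  "left_cancellative quotient_carrier quotient_meet_op quotient_join_op \<longleftrightarrow>
    (\<forall>x y z. (x \<squnion> y, x \<squnion> z) \<in> right_rel \<and> (x \<sqinter> y, x \<sqinter> z) \<in> right_rel \<longrightarrow> (y, z) \<in> right_rel)"
  by (simp add: left_cancellative_def)

section \<open>Left cancellation in the quotient\<close>

text \<open>This is the argument that distributive lattices are cancellative, carried out up to
  Green's relation D. As \<open>b = (a \<squnion> c) \<sqinter> b\<close>, distributivity replaces
  \<open>b\<close> by \<open>a \<sqinter> b\<close> between the two copies of \<open>c\<close>; this
  meet has \<open>c\<close> as an inner factor, so \<open>join_sandwich\<close> removes it.\<close>

lemma join_sandwich_of_right_rel:
  assumes "skew_distributive UNIV (\<sqinter>) (\<squnion>)"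
    and "(a \<squnion> b, a \<squnion> c) \<in> right_rel" "(a \<sqinter> b, a \<sqinter> c) \<in> right_rel"
  shows "c \<squnion> b \<squnion> c = c"
proof -
  have dist: "c \<squnion> (y \<sqinter> z) \<squnion> c = (c \<squnion> y \<squnion> c) \<sqinter> (c \<squnion> z \<squnion> c)" for y z
    using assms(1) by (simp add: skew_distributive_def)
  have "b = (a \<squnion> c) \<sqinter> b"
    using assms(2) by (metis join_meet_absorb_right meet_assoc right_rel_iff)
  then have "c \<squnion> b \<squnion> c = (c \<squnion> a \<squnion> c) \<sqinter> (c \<squnion> b \<squnion> c)"
    by (metis dist join_assoc join_idem)
  also have "\<dots> = c \<squnion> (a \<sqinter> b) \<squnion> c"
    by (rule dist[symmetric])
  also have "\<dots> = c \<squnion> (a \<sqinter> (c \<sqinter> (a \<sqinter> b))) \<squnion> c"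
    using assms(3) by (metis meet_assoc right_rel_iff)
  also have "\<dots> = c"
    by (simp add: join_assoc join_sandwich)
  finally show ?thesis .
qed

text \<open>The hypothesis gives \<open>c = c \<sqinter> b \<sqinter> (c \<squnion> b)\<close>, so
  meeting \<open>c\<close> with \<open>c \<sqinter> b\<close> on the left fixes it.\<close>

lemma meet_sandwich_of_join_sandwich:
  assumes "b \<squnion> c \<squnion> b = b"
  shows "c \<sqinter> b \<sqinter> c = c"
proof -
  have "b \<sqinter> (c \<squnion> b) = c \<squnion> b"
    using assms by (simp add: join_assoc flip: join_eq_left_iff)
  then have c: "c \<sqinter> b \<sqinter> (c \<squnion> b) = c"
    by (simp add: meet_assoc)
  show ?thesis
    using meet_left_idem[of "c \<sqinter> b" "c \<squnion> b"] unfolding c .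
qed

text \<open>In terms of meet, the dual relation is Green's relation L.\<close>

lemma eq_of_right_rel_dual:
  assumes "(u, v) \<in> right_rel" "(u, v) \<in> total_skew_lattice.right_rel (\<squnion>)"
  shows "u = v"
proof -
  interpret dual: total_skew_lattice "(\<squnion>)" "(\<sqinter>)"
    by (rule total_skew_lattice_dual)
  have "u \<sqinter> v = v" "u \<sqinter> v = u"
    using assms right_rel_iff dual.right_rel_iff_join by blast+
  then show ?thesis
    by metis
qed

lemma left_cancellative_quotientI:
  assumes D: "skew_distributive UNIV (\<sqinter>) (\<squnion>)" and C: "left_cancellative UNIV (\<sqinter>) (\<squnion>)"
  shows "left_cancellative quotient_carrier quotient_meet_op quotient_join_op"
  unfolding left_cancellative_quotient
proof (intro allI impI, elim conjE)
  fix x y z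
  assume join_rel: "(x \<squnion> y, x \<squnion> z) \<in> right_rel" and meet_rel: "(x \<sqinter> y, x \<sqinter> z) \<in> right_rel"
  interpret dual: total_skew_lattice "(\<squnion>)" "(\<sqinter>)"
    by (rule total_skew_lattice_dual)
  have trans: "(u, w) \<in> right_rel" if "(u, v) \<in> right_rel" "(v, w) \<in> right_rel" for u v w
    using that equiv_right_rel by (meson equivE transE)
  have sym: "(v, u) \<in> right_rel" if "(u, v) \<in> right_rel" for u v
    using that by (simp add: right_rel_iff)
  have "z \<squnion> y \<squnion> z = z" "y \<squnion> z \<squnion> y = y"
    using join_sandwich_of_right_rel[OF D] join_rel meet_rel sym by blast+
  then have zyz: "z \<sqinter> y \<sqinter> z = z" and yzy: "y \<sqinter> z \<sqinter> y = y"
    using meet_sandwich_of_join_sandwich by blast+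
  \<comment> \<open>Both the joins and the meets of \<open>x\<close> with \<open>y\<close> and with
    \<open>w\<close> are related by R and by L, hence equal, so cancellation applies to
    \<open>y\<close> and \<open>w\<close>.\<close>
  define w where "w = z \<sqinter> y"
  have zw: "(z, w) \<in> right_rel"
    using zyz by (simp add: w_def right_rel_iff)
  have "(y, w) \<in> dual.right_rel"
    using yzy by (simp add: w_def dual.right_rel_iff_join meet_assoc)
  then have "(x \<squnion> y, x \<squnion> w) \<in> dual.right_rel" "(x \<sqinter> y, x \<sqinter> w) \<in> dual.right_rel"
    by (simp_all add: dual.right_rel_meet dual.right_rel_join)
  moreover have "(x \<squnion> y, x \<squnion> w) \<in> right_rel" "(x \<sqinter> y, x \<sqinter> w) \<in> right_rel"
    using join_rel meet_rel zw trans right_rel_refl right_rel_join right_rel_meet by meson+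
  ultimately have "x \<squnion> y = x \<squnion> w" "x \<sqinter> y = x \<sqinter> w"
    using eq_of_right_rel_dual by blast+
  then have "y = w"
    by (rule left_cancelD[OF C])
  then show "(y, z) \<in> right_rel"
    using zw sym by simp
qed

section \<open>Combining the two quotients\<close>

lemma total_braid_iff:
  "braid_identity UNIV (\<sqinter>) (\<squnion>) \<longleftrightarrow>
    skew_distributive UNIV (\<sqinter>) (\<squnion>) \<and> left_cancellative UNIV (\<sqinter>) (\<squnion>)"
proof -
  interpret dual: total_skew_lattice "(\<squnion>)" "(\<sqinter>)"
    by (rule total_skew_lattice_dual)
  show ?thesis
  proof (intro iffI conjI; (elim conjE)?)
    assume B: "braid_identity UNIV (\<sqinter>) (\<squnion>)"
    then have "braid_identity quotient_carrier quotient_meet_op quotient_join_op"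
      by (simp add: braid_identity_quotient) (simp add: braid_identity_def)
    then have 1: "skew_distributive quotient_carrier quotient_meet_op quotient_join_op"
      "left_cancellative quotient_carrier quotient_meet_op quotient_join_op"
      by (simp_all add: quotient_braid_iff)
    have "braid_identity UNIV (\<squnion>) (\<sqinter>)"
      using B braid_identity_dual by blast
    then have "braid_identity dual.quotient_carrier dual.quotient_meet_op dual.quotient_join_op"
      by (simp add: dual.braid_identity_quotient) (simp add: braid_identity_def)
    then have 2: "skew_distributive dual.quotient_carrier dual.quotient_meet_op dual.quotient_join_op"
      "left_cancellative dual.quotient_carrier dual.quotient_meet_op dual.quotient_join_op"
      by (simp_all add: dual.quotient_braid_iff)
    show "skew_distributive UNIV (\<sqinter>) (\<squnion>)"
      using 1(1) 2(1) eq_of_right_rel_dual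
      unfolding skew_distributive_def[of UNIV] skew_distributive_quotient dual.skew_distributive_quotient
      by blast
    show "left_cancellative UNIV (\<sqinter>) (\<squnion>)"
      unfolding left_cancellative_def
    proof (intro ballI impI, elim conjE)
      fix x y z
      assume "x \<squnion> y = x \<squnion> z" "x \<sqinter> y = x \<sqinter> z"
      then show "y = z"
        using 1(2) 2(2) unfolding left_cancellative_quotient dual.left_cancellative_quotient
        by (metis eq_of_right_rel_dual right_rel_refl dual.right_rel_refl)
    qed
  next
    assume D: "skew_distributive UNIV (\<sqinter>) (\<squnion>)" and C: "left_cancellative UNIV (\<sqinter>) (\<squnion>)"
    have D': "skew_distributive UNIV (\<squnion>) (\<sqinter>)" and C': "left_cancellative UNIV (\<squnion>) (\<sqinter>)"
      using D C skew_distributive_dual left_cancellative_dual by blast+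
    have "skew_distributive quotient_carrier quotient_meet_op quotient_join_op"
      using D by (simp add: skew_distributive_quotient) (simp add: skew_distributive_def)
    then have 1: "braid_identity quotient_carrier quotient_meet_op quotient_join_op"
      using left_cancellative_quotientI[OF D C] quotient_braid_iff by blast
    have "skew_distributive dual.quotient_carrier dual.quotient_meet_op dual.quotient_join_op"
      using D' by (simp add: dual.skew_distributive_quotient) (simp add: skew_distributive_def)
    then have "braid_identity dual.quotient_carrier dual.quotient_meet_op dual.quotient_join_op"
      using dual.left_cancellative_quotientI[OF D' C'] dual.quotient_braid_iff by blast
    \<comment> \<open>The meet of the dual quotient is induced by \<open>\<squnion>\<close>, so the
      identity is dualized back before the two quotients are compared.\<close>
    then have 2: "braid_identity dual.quotient_carrier dual.quotient_join_op dual.quotient_meet_op"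
      using braid_identity_dual by blast
    show "braid_identity UNIV (\<sqinter>) (\<squnion>)"
      using 1 2 eq_of_right_rel_dual by (simp add: braid_identity_def)
  qed
qed

end

theorem mainTheorem14:
  fixes S :: "'a set" and meet join :: "'a \<Rightarrow> 'a \<Rightarrow> 'a"
  assumes "skew_lattice S meet join"
  shows "left_distributive_solution S meet join \<longleftrightarrow>
           skew_distributive S meet join \<and> left_cancellative S meet join"
proof -
  interpret total_skew_lattice "bottom_meet S meet" "bottom_join S join"
    by unfold_locales (rule skew_lattice_bottom[OF assms])
  show ?thesis
    using total_braid_iff assms
    by (simp add: left_distributive_solution_iff braid_identity_bottom skew_distributive_bottom
        left_cancellative_bottom)
qed

end
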